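(* Let $S\neq\mathbb Z_{\ge 0}$ be a numerical semigroup, let $m\in S$ be nonzero, and let $c_1<\dots<c_n$ be the elements of $\mathbb Z_{\ge 0}\setminus S$. Let $p$ be an integer with $0<p\le m$, let $f:\mathbb Z_{\ge 0}\to X$ be an arbitrary function to a set $X$, and let $F(x_1,\dots,x_p)$ be a symmetric function of $p$ variables in $X$ with values in an abelian group. Then $$\sum_{i=1}^n\left(\sum_{J\subset T_i,\ |J|=p-1}F(f\{J\},f(c_i+m))-\sum_{J\subset T_i,\ |J|=p-1}F(f\{J\},f(c_i))\right)=\sum_{I\subset S^{(m)},\ |I|=p}F(f\{I\})-\sum_{I\subset I_m,\ |I|=p}F(f\{I\}).$$ In particular, for $p=m$, $$\sum_{i=1}^n\bigl(F(f\{T_i\},f(c_i+m))-F(f\{T_i\},f(c_i))\bigr)=F(f\{S^{(m)}\})-F(f\{I_m\}).$$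
   Context: A numerical semigroup is a set $S\subset\mathbb Z_{\ge 0}$ that contains $0$, is closed under addition and has finite complement in $\mathbb Z_{\ge 0}$. For a numerical semigroup $S$ and a nonzero $m\in S$, the Apéry set is $S^{(m)}:=\{s\in S: s-m\notin S\}$; it has exactly $m$ elements, one in each residue class mod $m$, and contains $0$. Put $I_m:=\{0,1,\dots,m-1\}$. With $\mathbb Z_{\ge 0}\setminus S=\{c_1<\dots<c_n\}$, let $S_0:=\mathbb Z_{\ge 0}$ and $S_i:=\mathbb Z_{\ge 0}\setminus\{c_1,\dots,c_i\}$ for $i=1,\dots,n$ (so $S_n=S$); each $S_i$ is a numerical semigroup containing $m$. For $i=1,\dots,n$ put $T_i:=S_i^{(m)}\setminus\{c_i+m\}=S_{i-1}^{(m)}\setminus\{c_i\}$, a set of $m-1$ elements. For a finite set $A\subset\mathbb Z_{\ge 0}$, $f\{A\}$ denotes the family $(f(a))_{a\in A}$ of $|A|$ values counted with multiplicity, in any order (the order is irrelevant since $F$ is symmetric, i.e. invariant under all permutations of its arguments); $(f\{J\},u)$ denotes this family with the entry $u$ appended. *)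

theory Defs
  imports Main "HOL-Combinatorics.Permutations"
begin

definition numerical_semigroup :: "nat set \<Rightarrow> bool" where
  "numerical_semigroup S \<longleftrightarrow> 0 \<in> S \<and> (\<forall>a\<in>S. \<forall>b\<in>S. a + b \<in> S) \<and> finite (UNIV - S)"

(* The difference is taken in the integers: s < m must count as "s - m is not in S". *)
definition apery :: "nat set \<Rightarrow> nat \<Rightarrow> nat set" where
  "apery S m = {s \<in> S. int s - int m \<notin> int ` S}"

(* c 1 < ... < c n lists the gaps of S, so that semigroup_chain c n = S. *)
definition semigroup_chain :: "(nat \<Rightarrow> nat) \<Rightarrow> nat \<Rightarrow> nat set" where
  "semigroup_chain c i = UNIV - c ` {1..i}"

definition apery_common :: "(nat \<Rightarrow> nat) \<Rightarrow> nat \<Rightarrow> nat \<Rightarrow> nat set" where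
  "apery_common c m i = apery (semigroup_chain c i) m - {c i + m}"

(* A function of p variables is modelled by its values on lists of length p. *)
definition symmetric_function :: "nat \<Rightarrow> ('x list \<Rightarrow> 'g) \<Rightarrow> bool" where
  "symmetric_function p F \<longleftrightarrow>
     (\<forall>xs \<pi>. length xs = p \<longrightarrow> \<pi> permutes {..<p} \<longrightarrow> F (permute_list \<pi> xs) = F xs)"

(* Values of f on a finite set A, with multiplicity, listed along increasing elements of A. *)
definition family :: "(nat \<Rightarrow> 'x) \<Rightarrow> nat set \<Rightarrow> 'x list" where
  "family f A = map f (sorted_list_of_set A)"

end

(* Passing from S_(i-1) to S_i replaces c_i by c_i + m in the Apery set and leaves T_i unchanged.
   The p-subsets of the Apery set that avoid the exchanged element contribute equally on both
   sides, so the i-th summand is the difference of the full sums over p-subsets of the Apery sets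
   of S_i and S_(i-1), and the sum over i telescopes. *)
theory Submission
  imports Defs
begin

section \<open>Symmetric functions and sums over subsets of fixed size\<close>

lemma symmetric_function_mset_cong:
  assumes "symmetric_function p F" and "length ys = p" and "mset xs = mset ys"
  shows "F xs = F ys"
proof -
  obtain \<pi> where "\<pi> permutes {..<length ys}" and "permute_list \<pi> ys = xs"
    using mset_eq_permutation[OF assms(3)] .
  then show ?thesis
    using assms unfolding symmetric_function_def by metis
qed

lemma mset_family: "mset (family f A) = image_mset f (mset_set A)"
  by (simp add: family_def flip: sorted_list_of_mset_set)

text \<open>\<open>family\<close> puts \<open>f x\<close> wherever \<open>x\<close> falls in the
  sorted order, while the theorem appends it at the end. Both lists have the same multiset of
  values, which is all that a symmetric \<open>F\<close> sees.\<close>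

lemma symmetric_function_family_insert:
  assumes "symmetric_function p F" and "finite J" and "x \<notin> J" and "Suc (card J) = p"
  shows "F (family f (insert x J)) = F (family f J @ [f x])"
proof (rule symmetric_function_mset_cong[OF assms(1)])
  show "length (family f J @ [f x]) = p"
    using assms(4) by (simp add: family_def)
  show "mset (family f (insert x J)) = mset (family f J @ [f x])"
    using assms(2,3) by (simp add: mset_family)
qed

text \<open>Subsets are split by whether they contain \<open>x\<close>; deleting \<open>x\<close>
  matches those that do with the \<open>k\<close>-subsets of \<open>T\<close>.\<close>

lemma sum_subsets_insert:
  fixes g :: "'a set \<Rightarrow> 'g::comm_monoid_add"
  assumes "finite T" and "x \<notin> T"
  shows "(\<Sum>I | I \<subseteq> insert x T \<and> card I = Suc k. g I)
       = (\<Sum>I | I \<subseteq> T \<and> card I = Suc k. g I) + (\<Sum>J | J \<subseteq> T \<and> card J = k. g (insert x J))"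
proof -
  let ?A = "{I. I \<subseteq> T \<and> card I = Suc k}" and ?B = "{J. J \<subseteq> T \<and> card J = k}"
  have fin: "finite ?A" "finite ?B"
    using assms(1) by auto
  have eq: "{I. I \<subseteq> insert x T \<and> card I = Suc k} = ?A \<union> insert x ` ?B"
  proof (intro equalityI subsetI)
    fix I assume I: "I \<in> {I. I \<subseteq> insert x T \<and> card I = Suc k}"
    show "I \<in> ?A \<union> insert x ` ?B"
    proof (cases "x \<in> I")
      case True
      then have "I = insert x (I - {x})" "I - {x} \<in> ?B"
        using I by auto
      then show ?thesis by blast
    qed (use I in auto)
  next
    fix I assume "I \<in> ?A \<union> insert x ` ?B"
    then consider "I \<in> ?A" | J where "J \<in> ?B" "I = insert x J" by blast
    then show "I \<in> {I. I \<subseteq> insert x T \<and> card I = Suc k}"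
    proof cases
      case 2
      then have "finite J" "x \<notin> J"
        using assms by (auto intro: finite_subset)
      then show ?thesis using 2 by auto
    qed auto
  qed
  have "inj_on (insert x) ?B"
    using assms(2) by (intro inj_onI) (metis (no_types, lifting) insert_ident mem_Collect_eq subsetD)
  moreover have "?A \<inter> insert x ` ?B = {}"
    using assms(2) by auto
  ultimately show ?thesis
    using fin by (simp add: eq sum.union_disjoint sum.reindex)
qed

text \<open>By \<open>sum_subsets_insert\<close>, both sums on the right contain the same terms from
  \<open>I \<subseteq> T\<close>, which cancel. Only the subsets containing \<open>y\<close> or
  \<open>x\<close>, respectively, survive.\<close>

lemma exchange_sum:
  fixes F :: "'x list \<Rightarrow> 'g::ab_group_add"
  assumes F: "symmetric_function p F" and "0 < p"
    and T: "finite T" "x \<notin> T" "y \<notin> T"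
  shows "(\<Sum>J | J \<subseteq> T \<and> card J = p - 1. F (family f J @ [f y]))
       - (\<Sum>J | J \<subseteq> T \<and> card J = p - 1. F (family f J @ [f x]))
       = (\<Sum>I | I \<subseteq> insert y T \<and> card I = p. F (family f I))
       - (\<Sum>I | I \<subseteq> insert x T \<and> card I = p. F (family f I))"
proof -
  obtain k where k: "p = Suc k"
    using \<open>0 < p\<close> gr0_implies_Suc by blast
  have *: "(\<Sum>J | J \<subseteq> T \<and> card J = k. F (family f (insert z J)))
         = (\<Sum>J | J \<subseteq> T \<and> card J = k. F (family f J @ [f z]))" if "z \<notin> T" for z
    using that T(1) k by (intro sum.cong symmetric_function_family_insert[OF F]) (auto dest: finite_subset)
  show ?thesis
    using T by (simp add: k sum_subsets_insert *)
qed

text \<open>Trades the integer difference for subtraction on \<open>nat\<close>. The case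
  \<open>x < m\<close> must stand apart, because truncation gives 0, an element of every numerical
  semigroup.\<close>

lemma mem_apery_iff: "x \<in> apery S m \<longleftrightarrow> x \<in> S \<and> (x < m \<or> x - m \<notin> S)"
proof (cases "x < m")
  case True
  then show ?thesis by (auto simp: apery_def)
next
  case False
  then have "int x - int m = int (x - m)" by simp
  then show ?thesis
    using False by (simp add: apery_def inj_image_mem_iff del: of_nat_diff)
qed

lemma sum_subsets_card_self:
  fixes g :: "'a set \<Rightarrow> 'g::comm_monoid_add"
  assumes "finite A" and "card A = k"
  shows "(\<Sum>J | J \<subseteq> A \<and> card J = k. g J) = g A"
proof -
  have "{J. J \<subseteq> A \<and> card J = k} = {A}"
    using assms card_subset_eq by auto
  then show ?thesis by simp
qed

section \<open>The chain of semigroups and its Apery sets\<close>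

context
  fixes S :: "nat set" and m n :: nat and c :: "nat \<Rightarrow> nat"
  assumes S: "numerical_semigroup S" and m: "m \<in> S" "m \<noteq> 0"
    and mono: "strict_mono_on {1..n} c" and gaps: "c ` {1..n} = UNIV - S"
begin

lemma gap_less_iff: "i \<in> {1..n} \<Longrightarrow> j \<in> {1..n} \<Longrightarrow> c i < c j \<longleftrightarrow> i < j"
  using mono by (rule strict_mono_on_less)

lemma semigroup_chain_0: "semigroup_chain c 0 = UNIV"
  by (simp add: semigroup_chain_def)

lemma semigroup_chain_n: "semigroup_chain c n = S"
  by (simp only: semigroup_chain_def gaps) blast

lemma semigroup_chain_Suc: "semigroup_chain c (Suc i) = semigroup_chain c i - {c (Suc i)}"
  by (auto simp: semigroup_chain_def atLeastAtMostSuc_conv)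

text \<open>The gaps removed so far are at most \<open>c i\<close>, as \<open>c\<close> is
  increasing. For \<open>i = 0\<close> nothing has been removed, so the value \<open>c 0\<close> is
  immaterial.\<close>

lemma mem_semigroup_chain:
  assumes "i \<le> n" and "c i < x" shows "x \<in> semigroup_chain c i"
proof -
  have "x \<noteq> c j" if "j \<in> {1..i}" for j
    using that assms gap_less_iff[of i j] by fastforce
  then show ?thesis unfolding semigroup_chain_def by blast
qed

lemma next_gap_mem_semigroup_chain:
  assumes "i < n" shows "c (Suc i) \<in> semigroup_chain c i"
proof -
  have "c (Suc i) \<noteq> c j" if "j \<in> {1..i}" for j
    using that assms gap_less_iff[of j "Suc i"] by fastforce
  then show ?thesis unfolding semigroup_chain_def by blast
qed

text \<open>If \<open>c (Suc i) - m\<close> were in \<open>S\<close>, adding \<open>m\<close> would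
  put a gap into \<open>S\<close>. So it is itself a gap, smaller since \<open>m\<close> is nonzero,
  and has already been removed from the chain.\<close>

lemma next_gap_mem_apery:
  assumes "i < n" shows "c (Suc i) \<in> apery (semigroup_chain c i) m"
proof -
  have "c (Suc i) - m \<notin> semigroup_chain c i" if "m \<le> c (Suc i)"
  proof -
    have "c (Suc i) \<notin> S"
      using gaps assms by force
    then have "c (Suc i) - m \<notin> S"
      using S m(1) that unfolding numerical_semigroup_def by (metis le_add_diff_inverse2)
    then obtain j where j: "j \<in> {1..n}" "c (Suc i) - m = c j"
      using gaps by blast
    then have "c j < c (Suc i)"
      using m(2) that by linarith
    then have "j < Suc i"
      using gap_less_iff[of j "Suc i"] j(1) assms by simp
    then show ?thesis
      using j by (auto simp: semigroup_chain_def)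
  qed
  then show ?thesis
    using next_gap_mem_semigroup_chain[OF assms] by (auto simp: mem_apery_iff)
qed

text \<open>\<open>c (Suc i) + m\<close> lies above every removed gap, and subtracting
  \<open>m\<close> gives the gap just removed. Hence it belongs to the new Apery set, and inserting
  it undoes the deletion in \<open>apery_common\<close>.\<close>

lemma apery_Suc_eq_insert:
  assumes "i < n"
  shows "apery (semigroup_chain c (Suc i)) m = insert (c (Suc i) + m) (apery_common c m (Suc i))"
  using mem_semigroup_chain[of "Suc i" "c (Suc i) + m"] assms m(2)
  by (auto simp: apery_common_def mem_apery_iff semigroup_chain_Suc)

text \<open>Removing \<open>c (Suc i)\<close> from the semigroup affects Apery membership only of
  \<open>c (Suc i)\<close>, which leaves, and of \<open>c (Suc i) + m\<close>, which enters.\<close>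

lemma apery_common_Suc:
  assumes "i < n"
  shows "apery_common c m (Suc i) = apery (semigroup_chain c i) m - {c (Suc i)}"
  using next_gap_mem_semigroup_chain[OF assms]
  by (auto simp: apery_common_def mem_apery_iff semigroup_chain_Suc)

lemma apery_eq_insert:
  assumes "i < n"
  shows "apery (semigroup_chain c i) m = insert (c (Suc i)) (apery_common c m (Suc i))"
  using next_gap_mem_apery[OF assms] by (auto simp: apery_common_Suc[OF assms])

lemma apery_semigroup_chain_0: "apery (semigroup_chain c 0) m = {0..<m}"
  by (auto simp: mem_apery_iff semigroup_chain_0)

lemma apery_common_notin:
  assumes "i < n"
  shows "c (Suc i) \<notin> apery_common c m (Suc i)" "c (Suc i) + m \<notin> apery_common c m (Suc i)"
  by (simp add: apery_common_Suc[OF assms]) (simp add: apery_common_def)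

text \<open>The size is \<open>m\<close> for the initial set \<open>{0..<m}\<close>, and each step
  exchanges one element for one new element.\<close>

lemma finite_card_apery:
  "i \<le> n \<Longrightarrow> finite (apery (semigroup_chain c i) m) \<and> card (apery (semigroup_chain c i) m) = m"
proof (induction i)
  case 0
  show ?case by (simp add: apery_semigroup_chain_0)
next
  case (Suc i)
  then have "i < n" by simp
  then show ?case
    using Suc.IH apery_common_notin[OF \<open>i < n\<close>]
    by (auto simp: apery_eq_insert apery_Suc_eq_insert)
qed

lemma finite_card_apery_common:
  assumes "i \<in> {1..n}"
  shows "finite (apery_common c m i) \<and> card (apery_common c m i) = m - 1"
proof -
  obtain j where j: "i = Suc j" "j < n"
    using assms by (cases i) auto
  then show ?thesis
    using finite_card_apery[of j] next_gap_mem_apery[of j] by (simp add: apery_common_Suc)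
qed

lemma sum_exchange_telescope:
  fixes F :: "'x list \<Rightarrow> 'g::ab_group_add"
  assumes F: "symmetric_function p F" and p: "0 < p"
  shows "(\<Sum>i=1..n.
            (\<Sum>J | J \<subseteq> apery_common c m i \<and> card J = p - 1. F (family f J @ [f (c i + m)]))
          - (\<Sum>J | J \<subseteq> apery_common c m i \<and> card J = p - 1. F (family f J @ [f (c i)])))
         = (\<Sum>I | I \<subseteq> apery S m \<and> card I = p. F (family f I))
         - (\<Sum>I | I \<subseteq> {0..<m} \<and> card I = p. F (family f I))"
    (is "(\<Sum>i=1..n. ?d i) = _")
proof -
  let ?G = "\<lambda>i. \<Sum>I | I \<subseteq> apery (semigroup_chain c i) m \<and> card I = p. F (family f I)"
  \<comment> \<open>\<open>exchange_sum\<close> applies with \<open>x = c (Suc i)\<close> and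
    \<open>y = c (Suc i) + m\<close>; inserting these into the common part gives the Apery sets
    before and after the step.\<close>
  have step: "?d (Suc i) = ?G (Suc i) - ?G i" if "i < n" for i
    using that finite_card_apery_common[of "Suc i"] apery_common_notin[OF that]
      exchange_sum[OF F p, where T = "apery_common c m (Suc i)"]
    by (simp add: apery_eq_insert apery_Suc_eq_insert)
  \<comment> \<open>Shifting the index lets the telescope start at \<open>?G 0\<close>, the sum for
    the full set of naturals.\<close>
  have "(\<Sum>i=1..n. ?d i) = (\<Sum>i<n. ?d (Suc i))"
    by (simp only: One_nat_def sum.atLeast1_atMost_eq)
  also have "\<dots> = (\<Sum>i<n. ?G (Suc i) - ?G i)"
    by (intro sum.cong refl step) simp
  also have "\<dots> = ?G n - ?G 0"
    by (rule sum_lessThan_telescope)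
  finally show ?thesis
    by (simp add: apery_semigroup_chain_0 semigroup_chain_n)
qed

end

theorem mainTheorem7:
  fixes S :: "nat set" and m n p :: nat and c :: "nat \<Rightarrow> nat"
    and f :: "nat \<Rightarrow> 'x" and F :: "'x list \<Rightarrow> 'g::ab_group_add"
  assumes "numerical_semigroup S" and "S \<noteq> UNIV"
    and "m \<in> S" and "m \<noteq> 0"
    and "strict_mono_on {1..n} c" and "c ` {1..n} = UNIV - S"
    and "0 < p" and "p \<le> m"
    and "symmetric_function p F"
  shows "(\<Sum>i=1..n.
            (\<Sum>J | J \<subseteq> apery_common c m i \<and> card J = p - 1. F (family f J @ [f (c i + m)]))
          - (\<Sum>J | J \<subseteq> apery_common c m i \<and> card J = p - 1. F (family f J @ [f (c i)])))
         = (\<Sum>I | I \<subseteq> apery S m \<and> card I = p. F (family f I))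
         - (\<Sum>I | I \<subseteq> {0..<m} \<and> card I = p. F (family f I))
       \<and> (p = m \<longrightarrow>
           (\<Sum>i=1..n. F (family f (apery_common c m i) @ [f (c i + m)])
                    - F (family f (apery_common c m i) @ [f (c i)]))
           = F (family f (apery S m)) - F (family f {0..<m}))"
proof (intro conjI impI)
  note chain = assms(1,3-6)
  note main = sum_exchange_telescope[OF chain assms(9,7), of f]
  show "(\<Sum>i=1..n.
            (\<Sum>J | J \<subseteq> apery_common c m i \<and> card J = p - 1. F (family f J @ [f (c i + m)]))
          - (\<Sum>J | J \<subseteq> apery_common c m i \<and> card J = p - 1. F (family f J @ [f (c i)])))
         = (\<Sum>I | I \<subseteq> apery S m \<and> card I = p. F (family f I))
         - (\<Sum>I | I \<subseteq> {0..<m} \<and> card I = p. F (family f I))"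
    by (fact main)
  assume "p = m"
  have "finite (apery S m)" "card (apery S m) = m"
    using finite_card_apery[OF chain, of n] by (simp_all add: semigroup_chain_n[OF chain])
  \<comment> \<open>For \<open>p = m\<close> every subset sum has a single term: the common part has
    exactly \<open>m - 1\<close> elements, and both \<open>apery S m\<close> and
    \<open>{0..<m}\<close> have \<open>m\<close>.\<close>
  moreover have "(\<Sum>J | J \<subseteq> apery_common c m i \<and> card J = m - 1. g J) = g (apery_common c m i)"
    if "i \<in> {1..n}" for i and g :: "nat set \<Rightarrow> 'g"
    using finite_card_apery_common[OF chain that] by (simp add: sum_subsets_card_self)
  ultimately show "(\<Sum>i=1..n. F (family f (apery_common c m i) @ [f (c i + m)])
                    - F (family f (apery_common c m i) @ [f (c i)]))
           = F (family f (apery S m)) - F (family f {0..<m})"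
    using main by (simp add: \<open>p = m\<close> sum_subsets_card_self)
qed

end
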